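(* Assume $M:=\max_{x\in S}r(x)>0$, $Y:=r(X)/M\in[0,1]$, and let $\nu$ be any probability distribution on $S$. If $X\sim\nu$, define $m_\nu:=\mathbb{E}_\nu[Y]=\sum_{x\in S}\nu(x)\,r(x)/M$. Then, for every $\tau\in(0,1)$, $$\max\Bigl\{0,\frac{m_\nu-\tau}{1-\tau}\Bigr\}\le\nu\bigl(\{x\in S:\,r(x)\ge\tau M\}\bigr)\le\min\Bigl\{1,\frac{m_\nu}{\tau}\Bigr\},$$ and equivalently, $$\max\Bigl\{0,1-\frac{m_\nu}{\tau}\Bigr\}\le\nu\bigl(\{x\in S:\,r(x)\le\tau M\}\bigr)\le\min\Bigl\{1,\frac{1-m_\nu}{1-\tau}\Bigr\}.$$ These bounds are sharp: given only $m_\nu$ and $M$, no stronger universal tail bounds can be obtained. Depending on weak versus strict threshold conventions, the extremal constants are either attained or approached by two-point laws supported at endpoint/threshold values.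
   Context: $P$ is a Markov transition kernel on a finite state space $S$ with $|S|\ge2$, with a stationary distribution $\pi$ of full support ($\pi(x)>0$ for all $x\in S$). All logarithms are natural, with $0\log0=0$. $D_{\mathrm{KL}}(\mu\|\nu)=\sum_{x\in S}\mu(x)\log\frac{\mu(x)}{\nu(x)}$. The local KL retention ratio is $r(x):=D_{\mathrm{KL}}(P(x,\cdot)\|\pi)/\log(1/\pi(x))$, which satisfies $0\le r(x)\le1$ for every $x\in S$. *)

theory Defs
  imports "HOL-Probability.Probability"
begin

text \<open>
  The state space is the finite set \<open>S\<close>; the kernel gives, for each state, a
  probability mass function.  \<open>set_pmf \<pi> = S\<close> says both that \<open>\<pi>\<close> lives on \<open>S\<close> and
  that it has full support; \<open>bind_pmf \<pi> P\<close> is the row vector \<open>\<pi> P\<close>.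
\<close>

definition stationary_chain :: "'a set \<Rightarrow> ('a \<Rightarrow> 'a pmf) \<Rightarrow> 'a pmf \<Rightarrow> bool" where
  "stationary_chain S P \<pi> \<longleftrightarrow>
     finite S \<and> card S \<ge> 2 \<and> set_pmf \<pi> = S \<and>
     (\<forall>x\<in>S. set_pmf (P x) \<subseteq> S) \<and> bind_pmf \<pi> P = \<pi>"

text \<open>
  The convention \<open>0 log 0 = 0\<close> is automatic, since the factor \<open>pmf \<mu> x\<close> vanishes.
  The divergence is only used with \<open>\<nu>\<close> positive on \<open>S\<close>.
\<close>

definition kl_div :: "'a set \<Rightarrow> 'a pmf \<Rightarrow> 'a pmf \<Rightarrow> real" where
  "kl_div S \<mu> \<nu> = (\<Sum>x\<in>S. pmf \<mu> x * ln (pmf \<mu> x / pmf \<nu> x))"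

definition retention :: "'a set \<Rightarrow> ('a \<Rightarrow> 'a pmf) \<Rightarrow> 'a pmf \<Rightarrow> 'a \<Rightarrow> real" where
  "retention S P \<pi> x = kl_div S (P x) \<pi> / ln (1 / pmf \<pi> x)"

definition max_retention :: "'a set \<Rightarrow> ('a \<Rightarrow> 'a pmf) \<Rightarrow> 'a pmf \<Rightarrow> real" where
  "max_retention S P \<pi> = Max (retention S P \<pi> ` S)"

definition normalized :: "'a set \<Rightarrow> ('a \<Rightarrow> 'a pmf) \<Rightarrow> 'a pmf \<Rightarrow> 'a \<Rightarrow> real" where
  "normalized S P \<pi> x = retention S P \<pi> x / max_retention S P \<pi>"

definition mean_normalized :: "'a set \<Rightarrow> ('a \<Rightarrow> 'a pmf) \<Rightarrow> 'a pmf \<Rightarrow> 'a pmf \<Rightarrow> real" where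
  "mean_normalized S P \<pi> \<nu> = measure_pmf.expectation \<nu> (normalized S P \<pi>)"

text \<open>
  \<open>achievable_laws M m\<close> collects the laws of \<open>Y = r(X)/M\<close>, \<open>X \<sim> \<nu>\<close>, over all finite chains
  and all \<open>\<nu>\<close> with maximal retention ratio \<open>M\<close> and mean \<open>E Y = m\<close>.  Every finite state
  space can be relabelled by natural numbers, so restricting to sets of naturals loses no law.
\<close>

definition achievable_laws :: "real \<Rightarrow> real \<Rightarrow> real pmf set" where
  "achievable_laws M m =
     {map_pmf (normalized T Q \<rho>) \<sigma> | (T :: nat set) Q \<rho> \<sigma>.
        stationary_chain T Q \<rho> \<and> set_pmf \<sigma> \<subseteq> T \<and>
        max_retention T Q \<rho> = M \<and> mean_normalized T Q \<rho> \<sigma> = m}"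

text \<open>The law on \<open>{a, b}\<close> with mean \<open>m\<close>, for \<open>a \<le> m \<le> b\<close> and \<open>a < b\<close>.\<close>

definition two_point_law :: "real \<Rightarrow> real \<Rightarrow> real \<Rightarrow> real pmf" where
  "two_point_law a b m =
     map_pmf (\<lambda>c. if c then b else a) (bernoulli_pmf ((m - a) / (b - a)))"

text \<open>
  The law with mean \<open>m\<close> carried by \<open>s\<close> and one endpoint of \<open>[0, 1]\<close>, the endpoint being
  forced by the position of \<open>m\<close> relative to \<open>s\<close>.
\<close>

definition extremal_law :: "real \<Rightarrow> real \<Rightarrow> real pmf" where
  "extremal_law m s = (if m \<le> s then two_point_law 0 s m else two_point_law s 1 m)"

text \<open>
  The law is carried by two points, one within \<open>\<epsilon>\<close> of the threshold \<open>\<tau>\<close>, the other within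
  \<open>\<epsilon>\<close> of an endpoint.  Room is needed at the endpoint \<open>0\<close> too: a chain with \<open>M = 1\<close> has no
  state with \<open>r(x) = 0\<close>.
\<close>

definition near_extremal :: "real \<Rightarrow> real \<Rightarrow> real pmf \<Rightarrow> bool" where
  "near_extremal \<tau> \<epsilon> L \<longleftrightarrow>
     (\<exists>a b. set_pmf L \<subseteq> {a, b} \<and> \<bar>b - \<tau>\<bar> < \<epsilon> \<and> (\<bar>a\<bar> < \<epsilon> \<or> \<bar>a - 1\<bar> < \<epsilon>))"

end

theory Submission
  imports Defs "HOL-Real_Asymp.Real_Asymp"
begin

text \<open>
  Stationarity gives \<open>\<pi>(x) P(x, y) \<le> \<pi>(y)\<close>, hence \<open>r \<le> 1\<close>; together with Gibbs' inequality
  the tail bounds are Markov's inequality for \<open>Y\<close> and \<open>1 - Y\<close>.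

  For sharpness one realizes prescribed retention ratios by a doubly stochastic kernel on \<open>n\<close> points
  with the uniform \<open>\<pi>\<close>, where \<open>r(x) = 1 - H(P(x, \<cdot>)) / log n\<close>.  Split \<open>3N\<close> of the points into \<open>N\<close>
  blocks of size 3 and let the row of the \<open>i\<close>-th point of a block be a mixture, with weight \<open>t\<^sub>i\<close>, of
  the uniform laws on the block and on all \<open>3N\<close> points: the column sums are 1 for all weights, and by
  the intermediate value theorem each of the three weights can be tuned independently.  With \<open>n = 3N\<close>
  and \<open>N\<close> large this gives exactly the values \<open>0\<close>, \<open>sM\<close>, \<open>M\<close> for any \<open>M < 1\<close>.  If \<open>M = 1\<close> no state
  has \<open>r(x) = 0\<close>; adding one absorbing point (\<open>n = 3N + 1\<close>) produces \<open>1\<close> together with any two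
  values in \<open>(0, 1)\<close>.
\<close>

section \<open>Complements and finite mixtures of mass functions\<close>

lemma prob_pmf_Compl: "measure_pmf.prob L (- A) = 1 - measure_pmf.prob L A"
  using measure_pmf.prob_compl[of A L] by (simp add: Compl_eq_Diff_UNIV)

lemma pmf_bind_finite:
  assumes "finite S" "set_pmf \<pi> \<subseteq> S"
  shows "pmf (bind_pmf \<pi> P) y = (\<Sum>x\<in>S. pmf \<pi> x * pmf (P x) y)"
  unfolding pmf_bind using assms
  by (subst integral_measure_pmf_real[of S]) (auto simp: mult.commute)

subsection \<open>The range of the retention ratio\<close>

text \<open>Gibbs' inequality with its slack kept: \<open>ln u \<le> u - 1\<close> on the support of
  \<mu> leaves 1 minus the \<pi>-mass of that support. Besides nonnegativity, this shows that zero
  divergence forces \<mu> to charge all of \<open>S\<close>.\<close>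

lemma kl_div_ge_unreached_mass:
  assumes "finite S" "set_pmf \<mu> \<subseteq> S" "set_pmf \<pi> = S"
  shows "kl_div S \<mu> \<pi> \<ge> (\<Sum>y\<in>S - set_pmf \<mu>. pmf \<pi> y)"
proof -
  have "pmf \<mu> y - (if y \<in> set_pmf \<mu> then pmf \<pi> y else 0) \<le> pmf \<mu> y * ln (pmf \<mu> y / pmf \<pi> y)"
    if "y \<in> S" for y
  proof (cases "y \<in> set_pmf \<mu>")
    case True
    with that assms have p: "pmf \<mu> y > 0" "pmf \<pi> y > 0" by (auto simp: pmf_positive)
    have "ln (pmf \<pi> y / pmf \<mu> y) \<le> pmf \<pi> y / pmf \<mu> y - 1" using p by (intro ln_le_minus_one) simp
    then have "pmf \<mu> y * (1 - pmf \<pi> y / pmf \<mu> y) \<le> pmf \<mu> y * ln (pmf \<mu> y / pmf \<pi> y)"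
      using p by (intro mult_left_mono) (auto simp: ln_div)
    moreover have "pmf \<mu> y * (1 - pmf \<pi> y / pmf \<mu> y) = pmf \<mu> y - pmf \<pi> y"
      using p by (simp add: right_diff_distrib)
    ultimately show ?thesis using True by simp
  qed (simp add: set_pmf_iff)
  then have "(\<Sum>y\<in>S. pmf \<mu> y - (if y \<in> set_pmf \<mu> then pmf \<pi> y else 0)) \<le> kl_div S \<mu> \<pi>"
    unfolding kl_div_def by (intro sum_mono)
  moreover have "(\<Sum>y\<in>S. if y \<in> set_pmf \<mu> then pmf \<pi> y else 0) = (\<Sum>y\<in>S \<inter> set_pmf \<mu>. pmf \<pi> y)"
    using assms by (simp add: sum.inter_restrict)
  moreover have "(\<Sum>y\<in>S. pmf \<pi> y) = (\<Sum>y\<in>S \<inter> set_pmf \<mu>. pmf \<pi> y) + (\<Sum>y\<in>S - set_pmf \<mu>. pmf \<pi> y)"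
    using assms by (subst sum.union_disjoint[symmetric]) (auto intro!: sum.cong)
  ultimately show ?thesis using assms sum_pmf_eq_1[of S \<mu>] sum_pmf_eq_1[of S \<pi>]
    by (simp add: sum_subtractf)
qed

context
  fixes S :: "'a set" and P \<pi>
  assumes chain: "stationary_chain S P \<pi>"
begin

lemma chain_simps:
  "finite S" "S \<noteq> {}" "set_pmf \<pi> = S" "x \<in> S \<Longrightarrow> set_pmf (P x) \<subseteq> S" "x \<in> S \<Longrightarrow> pmf \<pi> x > 0"
  using chain by (auto simp: stationary_chain_def pmf_positive)

lemma stationary_eq: "pmf \<pi> y = (\<Sum>x\<in>S. pmf \<pi> x * pmf (P x) y)"
  using pmf_bind_finite[of S \<pi> P y] chain by (simp add: stationary_chain_def)

lemma flow_le: "x \<in> S \<Longrightarrow> pmf \<pi> x * pmf (P x) y \<le> pmf \<pi> y"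
  unfolding stationary_eq[of y] using chain_simps by (intro member_le_sum) auto

text \<open>A second state \<open>z\<close> sending mass to \<open>y\<close> adds a positive term to
  the stationarity sum at \<open>y\<close>. This is the source of strictness in
  \<open>max_retention_less_1\<close>.\<close>

lemma flow_less:
  assumes "x \<in> S" "z \<in> S" "z \<noteq> x" "pmf (P z) y > 0"
  shows "pmf \<pi> x * pmf (P x) y < pmf \<pi> y"
proof -
  have "(\<Sum>w\<in>{x, z}. pmf \<pi> w * pmf (P w) y) \<le> pmf \<pi> y"
    unfolding stationary_eq[of y] using chain_simps assms by (intro sum_mono2) auto
  moreover have "pmf \<pi> z * pmf (P z) y > 0" using assms chain_simps by simp
  ultimately show ?thesis using assms by simp
qed

text \<open>Here \<open>card S \<ge> 2\<close> enters: full support puts mass on a second state,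
  which keeps the denominator of the retention ratio positive.\<close>

lemma pmf_stationary_less_1:
  assumes "x \<in> S" shows "pmf \<pi> x < 1"
proof -
  obtain z where z: "z \<in> S" "z \<noteq> x"
    using chain assms unfolding stationary_chain_def
    by (metis card_le_Suc0_iff_eq not_less_eq_eq numeral_2_eq_2)
  have "(\<Sum>w\<in>{x, z}. pmf \<pi> w) \<le> (\<Sum>w\<in>S. pmf \<pi> w)"
    using chain_simps z assms by (intro sum_mono2) auto
  moreover have "(\<Sum>w\<in>S. pmf \<pi> w) = 1" using chain_simps by (intro sum_pmf_eq_1) auto
  moreover have "pmf \<pi> z > 0" using z chain_simps by simp
  ultimately show ?thesis using z by simp
qed

lemma ln_inverse_stationary_pos: "x \<in> S \<Longrightarrow> ln (1 / pmf \<pi> x) > 0"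
  using pmf_stationary_less_1[of x] chain_simps(5)[of x] by (intro ln_gt_zero) (simp add: field_simps)

text \<open>The flow inequality reads \<open>P(x, y) / \<pi>(y) \<le> 1 / \<pi>(x)\<close>, so every
  logarithm in the divergence is at most \<open>ln (1 / \<pi>(x))\<close>, and averaging over
  \<open>y\<close> gives \<open>r(x) \<le> 1\<close>.\<close>

lemma kl_term_le:
  assumes "x \<in> S" "y \<in> S"
  shows "pmf (P x) y * ln (pmf (P x) y / pmf \<pi> y) \<le> pmf (P x) y * ln (1 / pmf \<pi> x)"
proof (cases "pmf (P x) y = 0")
  case False
  then have "pmf (P x) y > 0" by (simp add: less_le)
  moreover from this have "ln (pmf (P x) y / pmf \<pi> y) \<le> ln (1 / pmf \<pi> x)"
    using flow_le[of x y] chain_simps assms by (subst ln_le_cancel_iff) (auto simp: field_simps)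
  ultimately show ?thesis by simp
qed simp

lemma kl_bound_sum:
  assumes "x \<in> S"
  shows "(\<Sum>y\<in>S. pmf (P x) y * ln (1 / pmf \<pi> x)) = ln (1 / pmf \<pi> x)"
  unfolding sum_distrib_right[symmetric] using assms chain_simps by (subst sum_pmf_eq_1) auto

lemma retention_nonneg: "x \<in> S \<Longrightarrow> retention S P \<pi> x \<ge> 0"
  unfolding retention_def
  using kl_div_ge_unreached_mass[of S "P x" \<pi>] chain_simps ln_inverse_stationary_pos[of x]
    sum_nonneg[of "S - set_pmf (P x)" "pmf \<pi>"]
  by (intro divide_nonneg_pos) auto

lemma retention_le_1:
  assumes "x \<in> S" shows "retention S P \<pi> x \<le> 1"
proof -
  have "kl_div S (P x) \<pi> \<le> (\<Sum>y\<in>S. pmf (P x) y * ln (1 / pmf \<pi> x))"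
    unfolding kl_div_def using assms by (intro sum_mono kl_term_le)
  then have "kl_div S (P x) \<pi> \<le> ln (1 / pmf \<pi> x)" unfolding kl_bound_sum[OF assms] .
  then show ?thesis unfolding retention_def using ln_inverse_stationary_pos[OF assms]
    by (simp add: divide_le_eq)
qed

lemma max_retention_le_1: "max_retention S P \<pi> \<le> 1"
  unfolding max_retention_def using chain_simps retention_le_1 by auto

text \<open>Explains why \<open>M = 1\<close> is exceptional: \<open>r(z) = 0\<close> makes
  \<open>P z\<close> charge every state, since an unreached \<open>y\<close> would contribute
  \<open>\<pi>(y) > 0\<close> to the divergence. Then no other \<open>x\<close> is the only source
  of any \<open>y\<close>, and its ratio stays below 1.\<close>

lemma max_retention_less_1:
  assumes z: "z \<in> S" "retention S P \<pi> z = 0"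
  shows "max_retention S P \<pi> < 1"
proof -
  have reach: "pmf (P z) y > 0" if "y \<in> S" for y
  proof (rule ccontr)
    assume "\<not> pmf (P z) y > 0"
    then have "y \<in> S - set_pmf (P z)" using that by (auto simp: pmf_positive)
    then have "pmf \<pi> y \<le> (\<Sum>y\<in>S - set_pmf (P z). pmf \<pi> y)"
      using chain_simps by (intro member_le_sum) auto
    also have "\<dots> \<le> kl_div S (P z) \<pi>"
      using chain_simps z by (intro kl_div_ge_unreached_mass) auto
    also have "\<dots> = 0"
      using z ln_inverse_stationary_pos[of z] by (simp add: retention_def)
    finally show False using chain_simps(5)[OF that] by simp
  qed
  have "retention S P \<pi> x < 1" if x: "x \<in> S" for x
  proof (cases "x = z")
    case False
    obtain y where y: "y \<in> set_pmf (P x)" using set_pmf_not_empty[of "P x"] by auto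
    then have y': "y \<in> S" "pmf (P x) y > 0" using chain_simps x by (auto simp: pmf_positive)
    have "pmf \<pi> x * pmf (P x) y < pmf \<pi> y"
      using reach[OF y'(1)] False x z y' by (intro flow_less) auto
    then have "ln (pmf (P x) y / pmf \<pi> y) < ln (1 / pmf \<pi> x)"
      using chain_simps x y' by (subst ln_less_cancel_iff) (auto simp: field_simps)
    then have "pmf (P x) y * ln (pmf (P x) y / pmf \<pi> y) < pmf (P x) y * ln (1 / pmf \<pi> x)"
      using y' by simp
    \<comment> \<open>One strict term, at a \<open>y\<close> charged by \<open>P x\<close>, is
      enough; the others are compared weakly by \<open>kl_term_le\<close>.\<close>
    then have "kl_div S (P x) \<pi> < (\<Sum>y\<in>S. pmf (P x) y * ln (1 / pmf \<pi> x))"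
      unfolding kl_div_def using x y' chain_simps(1) kl_term_le
      by (intro sum_strict_mono_ex1) blast+
    then have "kl_div S (P x) \<pi> < ln (1 / pmf \<pi> x)" unfolding kl_bound_sum[OF x] .
    then show ?thesis using ln_inverse_stationary_pos[OF x] by (simp add: retention_def)
  qed (use z in simp)
  then show ?thesis unfolding max_retention_def using chain_simps by auto
qed

section \<open>The normalized ratio and its mean\<close>

lemma normalized_bounds:
  assumes "max_retention S P \<pi> > 0" "x \<in> S"
  shows "normalized S P \<pi> x \<in> {0..1}"
proof -
  have "retention S P \<pi> x \<le> max_retention S P \<pi>"
    unfolding max_retention_def using chain_simps assms by auto
  then show ?thesis using assms retention_nonneg[OF assms(2)] by (auto simp: normalized_def divide_le_eq)
qed

lemma mean_normalized_eq_sum: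
  assumes "set_pmf \<nu> \<subseteq> S"
  shows "mean_normalized S P \<pi> \<nu> = (\<Sum>x\<in>S. pmf \<nu> x * normalized S P \<pi> x)"
  unfolding mean_normalized_def using assms chain_simps
  by (subst integral_measure_pmf_real[of S]) (auto simp: mult.commute)

lemma mean_normalized_bounds:
  assumes "max_retention S P \<pi> > 0" "set_pmf \<nu> \<subseteq> S"
  shows "mean_normalized S P \<pi> \<nu> \<in> {0..1}"
proof -
  have "(\<Sum>x\<in>S. pmf \<nu> x * normalized S P \<pi> x) \<le> (\<Sum>x\<in>S. pmf \<nu> x * 1)"
    using normalized_bounds[OF assms(1)] by (intro sum_mono mult_left_mono) auto
  moreover have "(\<Sum>x\<in>S. pmf \<nu> x) = 1" using chain_simps assms by (intro sum_pmf_eq_1) auto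
  moreover have "(\<Sum>x\<in>S. pmf \<nu> x * normalized S P \<pi> x) \<ge> 0"
    using normalized_bounds[OF assms(1)] by (intro sum_nonneg) auto
  ultimately show ?thesis unfolding mean_normalized_eq_sum[OF assms(2)] by simp
qed

text \<open>By \<open>max_retention_less_1\<close> no ratio vanishes when \<open>M = 1\<close>, so
  any state charged by \<nu> contributes positively. This supplies the condition
  \<open>M = 1 \<Longrightarrow> 0 < m\<close> of the sharpness lemmas.\<close>

lemma mean_normalized_pos:
  assumes "max_retention S P \<pi> = 1" "set_pmf \<nu> \<subseteq> S"
  shows "mean_normalized S P \<pi> \<nu> > 0"
proof -
  obtain x where x: "x \<in> set_pmf \<nu>" using set_pmf_not_empty[of \<nu>] by auto
  have "pmf \<nu> x * normalized S P \<pi> x > 0"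
    using x assms max_retention_less_1[of x] retention_nonneg[of x]
    by (auto simp: set_pmf_iff normalized_def less_le)
  then show ?thesis unfolding mean_normalized_eq_sum[OF assms(2)]
    using x assms chain_simps normalized_bounds by (intro sum_pos2[of S x]) auto
qed

end

subsection \<open>Tail bounds for laws on the unit interval\<close>

text \<open>Transfers every statement on upper tails to lower tails by complementation.\<close>

lemma one_minus_tail_constants:
  fixes m \<tau> :: real
  assumes "\<tau> \<in> {0<..<1}"
  shows "max 0 (1 - m / \<tau>) = 1 - min 1 (m / \<tau>)"
    and "min 1 ((1 - m) / (1 - \<tau>)) = 1 - max 0 ((m - \<tau>) / (1 - \<tau>))"
  using assms by (auto simp: min_def max_def field_simps)

text \<open>Integrates \<open>\<tau> * indicator A y \<le> y \<le> \<tau> + (1 - \<tau>) * indicator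
  A y\<close>, valid on the unit interval. Placing \<open>A\<close> between the strict and the weak
  ray treats both conventions at once.\<close>

lemma upper_tail_bounds:
  fixes L :: "real pmf"
  assumes L: "set_pmf L \<subseteq> {0..1}" and \<tau>: "\<tau> \<in> {0<..<1}" and A: "{\<tau><..} \<subseteq> A" "A \<subseteq> {\<tau>..}"
    and m: "m = measure_pmf.expectation L (\<lambda>y. y)"
  shows "max 0 ((m - \<tau>) / (1 - \<tau>)) \<le> measure_pmf.prob L A" "measure_pmf.prob L A \<le> min 1 (m / \<tau>)"
proof -
  have A': "y \<notin> A \<Longrightarrow> y \<le> \<tau>" "y \<in> A \<Longrightarrow> \<tau> \<le> y" for y using A by force+
  have int: "integrable L (\<lambda>y. y)"
    using L by (intro measure_pmf.integrable_const_bound[of _ 1]) (auto simp: AE_measure_pmf_iff)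
  have intA: "integrable L (indicator A :: real \<Rightarrow> real)"
    by (rule measure_pmf.integrable_const_bound[of _ 1]) auto
  have "measure_pmf.expectation L (\<lambda>y. \<tau> * indicator A y) \<le> m"
    unfolding m using L A' \<tau> int intA
    by (intro integral_mono_AE integrable_mult_right Bochner_Integration.integrable_add)
      (auto simp: AE_measure_pmf_iff split: split_indicator)
  then have 1: "\<tau> * measure_pmf.prob L A \<le> m" by simp
  have "m \<le> measure_pmf.expectation L (\<lambda>y. \<tau> + (1 - \<tau>) * indicator A y)"
    unfolding m using L A' \<tau> int intA
    by (intro integral_mono_AE integrable_mult_right Bochner_Integration.integrable_add)
      (auto simp: AE_measure_pmf_iff split: split_indicator)
  then have 2: "m \<le> \<tau> + (1 - \<tau>) * measure_pmf.prob L A" using intA by simp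
  show "max 0 ((m - \<tau>) / (1 - \<tau>)) \<le> measure_pmf.prob L A"
    using 2 \<tau> by (auto simp: field_simps)
  show "measure_pmf.prob L A \<le> min 1 (m / \<tau>)"
    using 1 \<tau> by (auto simp: field_simps)
qed

subsection \<open>Two-point laws\<close>

lemma set_two_point_law: "set_pmf (two_point_law a b m) \<subseteq> {a, b}"
  by (auto simp: two_point_law_def)

lemma two_point_weight: "(a::real) \<le> m \<Longrightarrow> m \<le> b \<Longrightarrow> a < b \<Longrightarrow> (m - a) / (b - a) \<in> {0..1}"
  by (auto simp: field_simps)

lemma expectation_two_point_law:
  assumes "a \<le> m" "m \<le> b" "a < b"
  shows "measure_pmf.expectation (two_point_law a b m) (\<lambda>y. y) = m"
proof -
  have "b * (m - a) / (b - a) + a * (1 - (m - a) / (b - a)) = m"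
    using assms by (simp add: divide_simps) (simp add: algebra_simps)
  then show ?thesis using two_point_weight[OF assms] by (simp add: two_point_law_def)
qed

lemma prob_two_point_law:
  assumes "a \<le> m" "m \<le> b" "a < b"
  shows "measure_pmf.prob (two_point_law a b m) A =
    (m - a) / (b - a) * indicator A b + (1 - (m - a) / (b - a)) * indicator A a"
proof -
  have "measure_pmf.prob (two_point_law a b m) A =
      measure_pmf.expectation (two_point_law a b m) (indicator A)" by simp
  also have "\<dots> = (m - a) / (b - a) * indicator A b + (1 - (m - a) / (b - a)) * indicator A a"
    unfolding two_point_law_def integral_map_pmf using two_point_weight[OF assms] by (simp add: comp_def)
  finally show ?thesis .
qed

text \<open>
  The extremal law with its lower endpoint moved up to \<open>a\<close>: for \<open>M = 1\<close> the value \<open>0\<close> is not available.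
\<close>

definition perturbed_law :: "real \<Rightarrow> real \<Rightarrow> real \<Rightarrow> real pmf" where
  "perturbed_law a m s = (if m \<le> s then two_point_law a s m else two_point_law s 1 m)"

lemma extremal_law_eq: "extremal_law m s = perturbed_law 0 m s"
  by (simp add: extremal_law_def perturbed_law_def)

lemma set_perturbed_law:
  "set_pmf (perturbed_law a m s) \<subseteq> {a, s} \<or> set_pmf (perturbed_law a m s) \<subseteq> {s, 1}"
  using set_two_point_law by (auto simp: perturbed_law_def)

context
  fixes a m s :: real
  assumes *: "0 \<le> a" "a \<le> m" "m \<le> 1" "a < s" "s < 1"
begin

lemma expectation_perturbed_law: "measure_pmf.expectation (perturbed_law a m s) (\<lambda>y. y) = m"
  using * by (simp add: perturbed_law_def expectation_two_point_law)

text \<open>The \<open>min\<close> and \<open>max\<close> encode the position of \<open>m\<close>.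
  If \<open>s \<in> A\<close>, the upper branch has both atoms in \<open>A\<close>; if
  \<open>s \<notin> A\<close>, the lower branch has both outside. In the remaining cases only the
  larger atom counts.\<close>

lemma prob_perturbed_law:
  assumes "a \<notin> A" "1 \<in> A"
  shows "s \<in> A \<Longrightarrow> measure_pmf.prob (perturbed_law a m s) A = min 1 ((m - a) / (s - a))"
    and "s \<notin> A \<Longrightarrow> measure_pmf.prob (perturbed_law a m s) A = max 0 ((m - s) / (1 - s))"
  using * assms by (auto simp: perturbed_law_def prob_two_point_law min_def max_def field_simps)

end

subsection \<open>Chains with prescribed retention ratios\<close>

text \<open>Continuity at 0 is what lets the mixture weight run up to \<open>t = 1\<close>, where
  the mass outside the block vanishes.\<close>

lemma continuous_on_x_ln_x: "continuous_on {0..} (\<lambda>x::real. x * ln x)"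
proof (subst continuous_on_eq_continuous_within, intro ballI)
  fix x :: real assume "x \<in> {0..}"
  show "continuous (at x within {0..}) (\<lambda>x. x * ln x)"
  proof (cases "x = 0")
    case True
    have "((\<lambda>x::real. x * ln x) \<longlongrightarrow> 0) (at_right 0)" by real_asymp
    then show ?thesis using True by (simp add: continuous_within at_within_Ici_at_right)
  qed (intro continuous_intros)
qed

section \<open>The block chain: divergences of its rows and stationarity\<close>

definition block_row :: "nat \<Rightarrow> real \<Rightarrow> nat \<Rightarrow> nat pmf" where
  "block_row N t b = bind_pmf (bernoulli_pmf t)
     (\<lambda>c. if c then pmf_of_set {3 * b..<3 * b + 3} else pmf_of_set {..<3 * N})"

text \<open>The weight depends only on the position \<open>x mod 3\<close> within a block, so all
  blocks carry the same three weights. Points from \<open>3 * N\<close> on are absorbing.\<close>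

definition block_chain :: "nat \<Rightarrow> (nat \<Rightarrow> real) \<Rightarrow> nat \<Rightarrow> nat pmf" where
  "block_chain N t x = (if x < 3 * N then block_row N (t (x mod 3)) (x div 3) else return_pmf x)"

lemma pmf_block_row:
  assumes "N \<ge> 1" "t \<in> {0..1}"
  shows "pmf (block_row N t b) y =
    t * indicator {3 * b..<3 * b + 3} y / 3 + (1 - t) * indicator {..<3 * N} y / (3 * N)"
proof -
  have "{..<3 * N} \<noteq> {}" using assms by (simp add: lessThan_empty_iff)
  then show ?thesis using assms
    by (simp add: block_row_def pmf_bind lessThan_empty_iff mult.commute)
qed

lemma set_block_row: "N \<ge> 1 \<Longrightarrow> b < N \<Longrightarrow> set_pmf (block_row N t b) \<subseteq> {..<3 * N}"
  by (auto simp: block_row_def lessThan_empty_iff split: if_splits)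

text \<open>Against the uniform law the divergence is \<open>ln n\<close> minus the entropy of the
  row, whose values are \<open>p\<close> on the 3 points of the block, \<open>q\<close> on the other
  \<open>3 * N - 3\<close> block points and 0 beyond.\<close>

lemma kl_div_block_row:
  assumes N: "N \<ge> 1" "3 * N \<le> n" "b < N" and t: "t \<in> {0..1}"
  defines "q \<equiv> (1 - t) / (3 * N)" and "p \<equiv> t / 3 + (1 - t) / (3 * N)"
  shows "kl_div {..<n} (block_row N t b) (pmf_of_set {..<n}) =
    ln n + 3 * (p * ln p) + (3 * real N - 3) * (q * ln q)"
proof -
  let ?r = "pmf (block_row N t b)" and ?B = "{3 * b..<3 * b + 3}"
  have n: "n > 0" "{..<n} \<noteq> {}" using N by (auto simp: lessThan_empty_iff)
  have r: "?r y = p" if "y \<in> ?B" for y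
    using that N unfolding pmf_block_row[OF N(1) t] p_def by auto
  have r': "?r y = q" if "y \<in> {..<3 * N} - ?B" for y
    using that N unfolding pmf_block_row[OF N(1) t] q_def by auto
  have r'': "?r y = 0" if "y \<in> {..<n} - {..<3 * N}" for y
    using that N unfolding pmf_block_row[OF N(1) t] by auto
  have split: "?r y * ln (?r y / pmf (pmf_of_set {..<n}) y) = ?r y * ln n + ?r y * ln (?r y)"
    if "y \<in> {..<n}" for y
    using that n by (cases "?r y = 0") (auto simp: ln_div ln_mult less_le algebra_simps lessThan_empty_iff)
  have "(\<Sum>y<n. ?r y) = 1"
    using set_block_row[of N b t] N by (intro sum_pmf_eq_1) auto
  moreover have "(\<Sum>y<n. ?r y * ln (?r y)) = 3 * (p * ln p) + (3 * real N - 3) * (q * ln q)"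
  proof -
    have "(\<Sum>y<n. ?r y * ln (?r y)) = (\<Sum>y<3 * N. ?r y * ln (?r y))"
      using N r'' by (intro sum.mono_neutral_right) auto
    also have "\<dots> = (\<Sum>y\<in>?B. ?r y * ln (?r y)) + (\<Sum>y\<in>{..<3 * N} - ?B. ?r y * ln (?r y))"
      using N by (subst sum.union_disjoint[symmetric]) (auto intro!: sum.cong)
    also have "(\<Sum>y\<in>?B. ?r y * ln (?r y)) = (\<Sum>y\<in>?B. p * ln p)"
      by (intro sum.cong) (auto simp del: atLeastLessThan_iff simp: r)
    also have "(\<Sum>y\<in>{..<3 * N} - ?B. ?r y * ln (?r y)) = (\<Sum>y\<in>{..<3 * N} - ?B. q * ln q)"
      by (intro sum.cong) (auto simp del: atLeastLessThan_iff Diff_iff simp: r')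
    also have "card ({..<3 * N} - ?B) = 3 * N - 3"
      using N by (subst card_Diff_subset) auto
    ultimately show ?thesis using N by (simp add: of_nat_diff)
  qed
  ultimately show ?thesis
    unfolding kl_div_def by (simp add: split sum.distrib flip: sum_distrib_right)
qed

text \<open>The intermediate value theorem in the weight: \<open>t = 0\<close> gives the uniform law
  on \<open>3 * N\<close> points, \<open>t = 1\<close> the uniform law on the block. The divergence
  does not depend on the block, so one \<open>t\<close> serves every \<open>b\<close>.\<close>

lemma block_row_retention_surj:
  fixes n N :: nat
  assumes N: "N \<ge> 1" "3 * N \<le> n" and v: "ln (n / (3 * N)) \<le> v" "v \<le> ln (n / 3)"
  obtains t where "t \<in> {0..1}"
    "\<And>b. b < N \<Longrightarrow> kl_div {..<n} (block_row N t b) (pmf_of_set {..<n}) = v"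
proof -
  define f :: "real \<Rightarrow> real" where "f t = ln n
      + 3 * ((t / 3 + (1 - t) / (3 * N)) * ln (t / 3 + (1 - t) / (3 * N)))
      + (3 * real N - 3) * ((1 - t) / (3 * N) * ln ((1 - t) / (3 * N)))" for t
  have cont: "continuous_on {0..1} (\<lambda>t. g t * ln (g t))"
    if "continuous_on {0..1} g" "\<And>t. t \<in> {0..1} \<Longrightarrow> g t \<ge> 0" for g :: "real \<Rightarrow> real"
    using that by (intro continuous_on_compose2[OF continuous_on_x_ln_x, of _ g]) auto
  have "continuous_on {0..1} f"
    unfolding f_def using N
    by (intro continuous_on_add continuous_on_mult_left continuous_on_const cont)
      (auto intro!: continuous_intros)
  moreover have "f 0 = ln (n / (3 * N))"
  proof -
    have "f 0 = ln n + (3 + (3 * real N - 3)) * (1 / (3 * N) * ln (1 / (3 * N)))"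
      unfolding f_def by (simp only: distrib_right) simp
    also have "\<dots> = ln (n / (3 * N))" using N by (simp add: ln_div)
    finally show ?thesis .
  qed
  moreover have "f 1 = ln (n / 3)" using N by (simp add: f_def ln_div)
  ultimately obtain t where "0 \<le> t" "t \<le> 1" "f t = v"
    using IVT'[of f 0 v 1] v by auto
  then show thesis using N by (intro that[of t]) (auto simp: kl_div_block_row f_def)
qed

lemma sum_mod_div_3:
  fixes f :: "nat \<Rightarrow> nat \<Rightarrow> real"
  shows "(\<Sum>x<3 * N. f (x mod 3) (x div 3)) = (\<Sum>b<N. f 0 b + f 1 b + f 2 b)"
proof (induction N)
  case (Suc N)
  have "{..<3 * Suc N} = insert (3 * N + 2) (insert (3 * N + 1) (insert (3 * N) {..<3 * N}))" by auto
  moreover have "(3 * N + 1) mod 3 = 1" "(3 * N + 2) mod 3 = 2" "(3 * N + 1) div 3 = N" "(3 * N + 2) div 3 = N"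
    by presburger+
  ultimately show ?case using Suc by simp
qed simp

text \<open>In a column \<open>y < 3 * N\<close> the block parts contribute
  \<open>(t 0 + t 1 + t 2) / 3\<close>, from the block of \<open>y\<close> alone, and the uniform
  parts the complementary amount. Column sums 1 make the uniform law stationary.\<close>

lemma stationary_block_chain:
  assumes N: "N \<ge> 1" "3 * N \<le> n" and t: "\<And>i. t i \<in> {0..1}"
  shows "stationary_chain {..<n} (block_chain N t) (pmf_of_set {..<n})"
proof -
  have n: "n \<ge> 3" "{..<n} \<noteq> {}" using N by (auto simp: lessThan_empty_iff)
  have col: "(\<Sum>x<n. pmf (block_chain N t x) y) = 1" if y: "y < n" for y
  proof -
    \<comment> \<open>\<open>?f i b\<close> is the entry in column \<open>y\<close> of the row of
      the \<open>i\<close>-th point of block \<open>b\<close>.\<close>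
    let ?f = "\<lambda>i b. t i * (if b = y div 3 then 1 else 0) / 3
        + (1 - t i) * (if y < 3 * N then 1 else 0) / (3 * N)"
    have "(\<Sum>x<n. pmf (block_chain N t x) y) =
        (\<Sum>x<3 * N. pmf (block_chain N t x) y) + (\<Sum>x\<in>{3 * N..<n}. pmf (block_chain N t x) y)"
      using N by (subst sum.union_disjoint[symmetric]) (auto intro!: sum.cong)
    also have "(\<Sum>x<3 * N. pmf (block_chain N t x) y) = (\<Sum>x<3 * N. ?f (x mod 3) (x div 3))"
      using N t by (intro sum.cong) (auto simp: block_chain_def pmf_block_row indicator_def)
    also have "\<dots> = (\<Sum>b<N. ?f 0 b + ?f 1 b + ?f 2 b)" by (rule sum_mod_div_3)
    also have "\<dots> = (\<Sum>b<N. (t 0 + t 1 + t 2) / 3 * (if b = y div 3 then 1 else 0)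
        + (3 - (t 0 + t 1 + t 2)) / (3 * N) * (if y < 3 * N then 1 else 0))"
      using N by (intro sum.cong) (auto simp: field_simps)
    also have "\<dots> = (t 0 + t 1 + t 2) / 3 * (if y < 3 * N then 1 else 0)
        + N * ((3 - (t 0 + t 1 + t 2)) / (3 * N) * (if y < 3 * N then 1 else 0))"
      unfolding sum.distrib sum_distrib_left[symmetric] by (auto simp: less_mult_imp_div_less)
    also have "\<dots> = (if y < 3 * N then 1 else 0)"
      using N by (simp add: field_simps)
    also have "(\<Sum>x\<in>{3 * N..<n}. pmf (block_chain N t x) y) =
        (\<Sum>x\<in>{3 * N..<n}. if x = y then 1 else 0)"
      by (intro sum.cong) (auto simp: block_chain_def)
    also have "\<dots> = (if y < 3 * N then 0 else 1)" using y by auto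
    finally show ?thesis by simp
  qed
  have rows: "set_pmf (block_chain N t x) \<subseteq> {..<n}" if "x < n" for x
  proof (cases "x < 3 * N")
    case True
    then have "x div 3 < N" by (simp add: less_mult_imp_div_less mult.commute)
    then show ?thesis using True N set_block_row[of N "x div 3" "t (x mod 3)"]
      by (auto simp: block_chain_def)
  qed (use that in \<open>simp add: block_chain_def\<close>)
  have "bind_pmf (pmf_of_set {..<n}) (block_chain N t) = pmf_of_set {..<n}"
  proof (rule pmf_eqI)
    fix y
    have "pmf (bind_pmf (pmf_of_set {..<n}) (block_chain N t)) y =
        (\<Sum>x<n. pmf (block_chain N t x) y) / n"
      using n by (subst pmf_bind_finite[of "{..<n}"]) (auto simp: sum_divide_distrib)
    also have "\<dots> = pmf (pmf_of_set {..<n}) y"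
    proof (cases "y < n")
      case False
      then have "pmf (block_chain N t x) y = 0" if "x < n" for x
        using rows[OF that] by (auto simp: set_pmf_iff)
      then show ?thesis using False n by simp
    qed (use col n in simp)
    finally show "pmf (bind_pmf (pmf_of_set {..<n}) (block_chain N t)) y = pmf (pmf_of_set {..<n}) y" .
  qed
  then show ?thesis using n rows by (auto simp: stationary_chain_def set_pmf_of_set)
qed

text \<open>For \<open>n = 3 * N\<close> and \<open>n = 3 * N + 1\<close> the ends of the admissible
  interval tend to 0 and 1 as \<open>N\<close> grows, so large \<open>N\<close> accommodates any
  fixed targets strictly between.\<close>

lemma chain_with_retentions:
  fixes n N :: nat
  assumes N: "N \<ge> 1" "3 * N \<le> n"
    and v: "\<And>i. i < 3 \<Longrightarrow> ln (n / (3 * N)) / ln n \<le> v i \<and> v i \<le> ln (n / 3) / ln n"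
  obtains Q where "stationary_chain {..<n} Q (pmf_of_set {..<n})"
    "\<And>x. x < 3 * N \<Longrightarrow> retention {..<n} Q (pmf_of_set {..<n}) x = v (x mod 3)"
    "\<And>x. 3 * N \<le> x \<Longrightarrow> x < n \<Longrightarrow> retention {..<n} Q (pmf_of_set {..<n}) x = 1"
proof -
  have n: "n \<ge> 3" "{..<n} \<noteq> {}" "ln (real n) > 0" using N by (auto simp: lessThan_empty_iff)
  \<comment> \<open>For \<open>i \<ge> 3\<close> the weight is set to 0, so that the chosen function
    takes values in the unit interval everywhere.\<close>
  have "\<exists>t. t \<in> {0..1} \<and> (i < 3 \<longrightarrow> (\<forall>b<N. kl_div {..<n} (block_row N t b) (pmf_of_set {..<n}) = v i * ln n))"
    for i
  proof (cases "i < 3")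
    case True
    then have "ln (n / (3 * N)) \<le> v i * ln n" "v i * ln n \<le> ln (n / 3)"
      using v[OF True] n by (auto simp: field_simps)
    then show ?thesis using block_row_retention_surj[OF N] by metis
  qed (auto intro: exI[of _ 0])
  then obtain t where t: "\<And>i. t i \<in> {0..1}" and
    kl: "\<And>i b. i < 3 \<Longrightarrow> b < N \<Longrightarrow> kl_div {..<n} (block_row N (t i) b) (pmf_of_set {..<n}) = v i * ln n"
    by metis
  have "n \<noteq> 1" using n by simp
  show thesis
  proof (rule that[of "block_chain N t"])
    show "stationary_chain {..<n} (block_chain N t) (pmf_of_set {..<n})"
      by (rule stationary_block_chain[OF N t])
    show "retention {..<n} (block_chain N t) (pmf_of_set {..<n}) x = v (x mod 3)" if "x < 3 * N" for x
      using that n(2) N \<open>n \<noteq> 1\<close> kl[of "x mod 3" "x div 3"] by (simp add: retention_def block_chain_def)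
    show "retention {..<n} (block_chain N t) (pmf_of_set {..<n}) x = 1" if "3 * N \<le> x" "x < n" for x
    proof -
      \<comment> \<open>A point mass has divergence \<open>ln n\<close>, which is exactly the
        normalizing logarithm.\<close>
      have "kl_div {..<n} (return_pmf x) (pmf_of_set {..<n}) = (\<Sum>y<n. if y = x then ln n else 0)"
        unfolding kl_div_def using n by (intro sum.cong) auto
      then show ?thesis using that n by (simp add: retention_def block_chain_def)
    qed
  qed
qed

subsection \<open>Achievable laws\<close>

text \<open>Choosing a preimage state for each value pulls \<open>L\<close> back to an initial law
  on \<open>T\<close>. Realizing a law thus reduces to realizing its support as values of the
  normalized ratio.\<close>

lemma achievable_law_of_chain:
  fixes T :: "nat set"
  assumes "stationary_chain T Q \<rho>" "set_pmf L \<subseteq> normalized T Q \<rho> ` T"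
  shows "L \<in> achievable_laws (max_retention T Q \<rho>) (measure_pmf.expectation L (\<lambda>y. y))"
proof -
  define \<sigma> where "\<sigma> = map_pmf (inv_into T (normalized T Q \<rho>)) L"
  have L: "map_pmf (normalized T Q \<rho>) \<sigma> = L"
    unfolding \<sigma>_def map_pmf_comp using assms(2) by (intro map_pmf_idI) (auto intro: f_inv_into_f)
  have "set_pmf \<sigma> \<subseteq> T" using assms(2) by (auto simp: \<sigma>_def intro: inv_into_into)
  moreover have "mean_normalized T Q \<rho> \<sigma> = measure_pmf.expectation L (\<lambda>y. y)"
    unfolding mean_normalized_def by (subst L[symmetric]) simp
  ultimately show ?thesis unfolding achievable_laws_def using assms(1) L by blast
qed

lemma chain_with_normalized_values:
  fixes M a s :: real
  assumes M: "0 < M" "M \<le> 1" "M = 1 \<Longrightarrow> 0 < a" and as: "0 \<le> a" "a < s" "s < 1"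
  obtains T :: "nat set" and Q \<rho> where "stationary_chain T Q \<rho>" "max_retention T Q \<rho> = M"
    "{a, s, 1} \<subseteq> normalized T Q \<rho> ` T"
proof (cases "M = 1")
  case True
  \<comment> \<open>With \<open>n = 3 * N + 1\<close> the lower end is positive but tends to 0,
    which is where \<open>0 < a\<close> is used; the absorbing point provides the maximum 1.\<close>
  have "eventually (\<lambda>N::nat. ln ((3 * real N + 1) / (3 * N)) / ln (3 * real N + 1) < a) at_top"
    using True M by real_asymp
  moreover have "eventually (\<lambda>N::nat. s < ln ((3 * real N + 1) / 3) / ln (3 * real N + 1)) at_top"
    using as by real_asymp
  moreover have "eventually (\<lambda>N::nat. N \<ge> 1) at_top" by (rule eventually_ge_at_top)
  ultimately have "eventually (\<lambda>N::nat. N \<ge> 1 \<and> ln ((3 * real N + 1) / (3 * N)) / ln (3 * real N + 1) < a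
      \<and> s < ln ((3 * real N + 1) / 3) / ln (3 * real N + 1)) at_top"
    by eventually_elim auto
  then obtain N :: nat where N: "N \<ge> 1" "ln ((3 * real N + 1) / (3 * N)) / ln (3 * real N + 1) < a"
      "s < ln ((3 * real N + 1) / 3) / ln (3 * real N + 1)"
    by (auto dest: eventually_happens)
  define n where "n = 3 * N + 1"
  have n: "real n = 3 * real N + 1" by (simp add: n_def)
  obtain Q where Q: "stationary_chain {..<n} Q (pmf_of_set {..<n})"
    "\<And>x. x < 3 * N \<Longrightarrow> retention {..<n} Q (pmf_of_set {..<n}) x = (if x mod 3 = 0 then a else s)"
    "\<And>x. 3 * N \<le> x \<Longrightarrow> x < n \<Longrightarrow> retention {..<n} Q (pmf_of_set {..<n}) x = 1"
  proof (rule chain_with_retentions[of N n "\<lambda>i. if i = 0 then a else s"])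
    show "ln (n / (3 * N)) / ln n \<le> (if i = 0 then a else s) \<and>
      (if i = 0 then a else s) \<le> ln (n / 3) / ln n" for i :: nat
      using N as unfolding n by auto
  qed (use N in \<open>auto simp: n_def\<close>)
  let ?r = "retention {..<n} Q (pmf_of_set {..<n})"
  have r: "?r 0 = a" "?r 1 = s" "?r (3 * N) = 1" using Q N by (auto simp: n_def)
  have "?r x \<le> 1" if "x < n" for x using retention_le_1[OF Q(1)] that by auto
  moreover have "1 \<in> ?r ` {..<n}" using r(3) by (intro image_eqI[of _ _ "3 * N"]) (auto simp: n_def)
  ultimately have max: "max_retention {..<n} Q (pmf_of_set {..<n}) = 1"
    unfolding max_retention_def by (intro Max_eqI) auto
  moreover have "{0, 1, 3 * N} \<subseteq> {..<n}" using N by (simp add: n_def)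
  from image_mono[OF this, of ?r] have "{a, s, 1} \<subseteq> ?r ` {..<n}" using r by simp
  ultimately show thesis using Q(1) True
    by (intro that[of "{..<n}" Q "pmf_of_set {..<n}"]) (auto simp: normalized_def)
next
  case False
  then have M1: "M < 1" using M by simp
  \<comment> \<open>With \<open>n = 3 * N\<close> the lower end is \<open>ln 1 = 0\<close>, so even
    \<open>a = 0\<close> is exact and only \<open>M\<close> restricts \<open>N\<close>.\<close>
  have "eventually (\<lambda>N::nat. M < ln (3 * real N / 3) / ln (3 * real N)) at_top"
    using M1 by real_asymp
  moreover have "eventually (\<lambda>N::nat. N \<ge> 1) at_top" by (rule eventually_ge_at_top)
  ultimately have "eventually (\<lambda>N::nat. N \<ge> 1 \<and> M < ln (3 * real N / 3) / ln (3 * real N)) at_top"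
    by eventually_elim auto
  then obtain N :: nat where N: "N \<ge> 1" "M < ln (3 * real N / 3) / ln (3 * real N)"
    by (auto dest: eventually_happens)
  define n where "n = 3 * N"
  define v where "v i = (if i = 0 then a * M else if i = 1 then s * M else M)" for i :: nat
  have v: "0 \<le> v i" "v i \<le> M" for i using M as by (auto simp: v_def mult_le_cancel_right2)
  obtain Q where Q: "stationary_chain {..<n} Q (pmf_of_set {..<n})"
    "\<And>x. x < 3 * N \<Longrightarrow> retention {..<n} Q (pmf_of_set {..<n}) x = v (x mod 3)"
  proof (rule chain_with_retentions[of N n v])
    show "ln (n / (3 * N)) / ln n \<le> v i \<and> v i \<le> ln (n / 3) / ln n" for i
      using v[of i] N by (auto simp: n_def)
  qed (use N in \<open>auto simp: n_def\<close>)
  let ?r = "retention {..<n} Q (pmf_of_set {..<n})"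
  have r: "?r 0 = a * M" "?r 1 = s * M" "?r 2 = M" using Q N by (auto simp: v_def)
  have "?r x \<le> M" if "x < n" for x using Q(2) v that by (auto simp: n_def)
  moreover have "M \<in> ?r ` {..<n}" using r(3) N by (intro image_eqI[of _ _ 2]) (auto simp: n_def)
  ultimately have max: "max_retention {..<n} Q (pmf_of_set {..<n}) = M"
    unfolding max_retention_def by (intro Max_eqI) auto
  have "normalized {..<n} Q (pmf_of_set {..<n}) 0 = a" "normalized {..<n} Q (pmf_of_set {..<n}) 1 = s"
    "normalized {..<n} Q (pmf_of_set {..<n}) 2 = 1"
    unfolding normalized_def max r using M by auto
  moreover have "{0, 1, 2} \<subseteq> {..<n}" using N by (simp add: n_def)
  from image_mono[OF this, of "normalized {..<n} Q (pmf_of_set {..<n})"]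
  have "normalized {..<n} Q (pmf_of_set {..<n}) ` {0, 1, 2} \<subseteq>
      normalized {..<n} Q (pmf_of_set {..<n}) ` {..<n}" .
  ultimately have "{a, s, 1} \<subseteq> normalized {..<n} Q (pmf_of_set {..<n}) ` {..<n}" by simp
  then show thesis using Q(1) max by (intro that)
qed

lemma perturbed_law_achievable:
  assumes M: "0 < M" "M \<le> 1" "M = 1 \<Longrightarrow> 0 < a"
    and "0 \<le> a" "a \<le> m" "m \<le> 1" "a < s" "s < 1"
  shows "perturbed_law a m s \<in> achievable_laws M m"
proof -
  obtain T :: "nat set" and Q \<rho> where T: "stationary_chain T Q \<rho>" "max_retention T Q \<rho> = M"
    "{a, s, 1} \<subseteq> normalized T Q \<rho> ` T"
    using chain_with_normalized_values[of M a s] assms by blast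
  have "set_pmf (perturbed_law a m s) \<subseteq> {a, s, 1}" using set_perturbed_law[of a m s] by auto
  then show ?thesis
    using achievable_law_of_chain[OF T(1), of "perturbed_law a m s"] T expectation_perturbed_law[of a m s] assms
    by auto
qed

lemma achievable_law_bounds:
  assumes "0 < M" "L \<in> achievable_laws M m"
  shows "set_pmf L \<subseteq> {0..1}" "measure_pmf.expectation L (\<lambda>y. y) = m"
proof -
  obtain T Q \<rho> \<sigma> where T: "stationary_chain T Q \<rho>" "set_pmf \<sigma> \<subseteq> (T :: nat set)" "max_retention T Q \<rho> = M"
    "mean_normalized T Q \<rho> \<sigma> = m" and L: "L = map_pmf (normalized T Q \<rho>) \<sigma>"
    using assms(2) unfolding achievable_laws_def by blast
  show "set_pmf L \<subseteq> {0..1}" using T normalized_bounds[OF T(1)] assms(1) unfolding L by auto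
  show "measure_pmf.expectation L (\<lambda>y. y) = m"
    using T(4) unfolding L mean_normalized_def by simp
qed

text \<open>
  Take the lower endpoint \<open>\<delta> * m\<close> and the threshold point \<open>\<tau> - \<delta>\<close> (infimum) or \<open>\<tau> + \<delta>\<close> (supremum),
  so that weak and strict tails at \<open>\<tau>\<close> agree, and let \<open>\<delta>\<close> tend to 0.
\<close>

lemma approx_tail_constants:
  fixes M m \<tau> \<epsilon> :: real
  assumes M: "0 < M" "M \<le> 1" "M = 1 \<Longrightarrow> 0 < m" and m: "0 \<le> m" "m \<le> 1"
    and \<tau>: "\<tau> \<in> {0<..<1}" and \<epsilon>: "\<epsilon> > 0"
  shows "\<exists>L\<in>achievable_laws M m. near_extremal \<tau> \<epsilon> L \<and>
      (\<forall>A. {\<tau><..} \<subseteq> A \<and> A \<subseteq> {\<tau>..} \<longrightarrow> \<bar>measure_pmf.prob L A - max 0 ((m - \<tau>) / (1 - \<tau>))\<bar> < \<epsilon>)"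
    and "\<exists>L\<in>achievable_laws M m. near_extremal \<tau> \<epsilon> L \<and>
      (\<forall>A. {\<tau><..} \<subseteq> A \<and> A \<subseteq> {\<tau>..} \<longrightarrow> \<bar>measure_pmf.prob L A - min 1 (m / \<tau>)\<bar> < \<epsilon>)"
proof -
  \<comment> \<open>\<open>\<delta> < \<tau> / 2\<close> puts the lower endpoint
    \<open>\<delta> * m\<close> below \<open>\<tau> - \<delta>\<close>, and
    \<open>\<delta> < 1 - \<tau>\<close> keeps \<open>\<tau> + \<delta>\<close> below 1. The factor
    \<open>m\<close> keeps the endpoint at most \<open>m\<close>, yet positive when
    \<open>m > 0\<close>.\<close>
  have small: "eventually (\<lambda>\<delta>. 0 < \<delta> \<and> \<delta> < \<epsilon> \<and> \<delta> < \<tau> / 2 \<and> \<delta> < 1 - \<tau>) (at_right (0::real))"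
    using \<tau> \<epsilon> unfolding eventually_at_right_field
    by (intro exI[of _ "min \<epsilon> (min (\<tau> / 2) (1 - \<tau>))"]) auto
  have near: "near_extremal \<tau> \<epsilon> (perturbed_law (\<delta> * m) m s)"
    if "0 < \<delta>" "\<delta> < \<epsilon>" "\<bar>s - \<tau>\<bar> < \<epsilon>" for \<delta> s
  proof -
    have "0 \<le> \<delta> * m" "\<delta> * m \<le> \<delta>" using that m mult_left_le[of m \<delta>] by simp_all
    then have "\<bar>\<delta> * m\<bar> < \<epsilon>" using that(2) by linarith
    moreover have "set_pmf (perturbed_law (\<delta> * m) m s) \<subseteq> {\<delta> * m, s} \<or>
        set_pmf (perturbed_law (\<delta> * m) m s) \<subseteq> {1, s}"
      using set_perturbed_law[of "\<delta> * m" m s] by (simp add: insert_commute)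
    moreover have "\<bar>1 - 1 :: real\<bar> < \<epsilon>" using \<epsilon> by simp
    ultimately show ?thesis using that(3) unfolding near_extremal_def by blast
  qed
  have ok: "\<delta> * m \<le> m" "\<delta> * m < s" if "0 < \<delta>" "\<delta> < 1" "\<delta> < s" for \<delta> s
    using that m mult_left_le[of m \<delta>] mult_left_le_one_le[of m \<delta>] by linarith+
  have "((\<lambda>\<delta>. max 0 ((m - (\<tau> - \<delta>)) / (1 - (\<tau> - \<delta>)))) \<longlongrightarrow> max 0 ((m - (\<tau> - 0)) / (1 - (\<tau> - 0)))) (at_right (0::real))"
    using \<tau> by (intro tendsto_intros) auto
  then have "eventually (\<lambda>\<delta>. \<bar>max 0 ((m - (\<tau> - \<delta>)) / (1 - (\<tau> - \<delta>))) - max 0 ((m - \<tau>) / (1 - \<tau>))\<bar> < \<epsilon>) (at_right 0)"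
    using \<epsilon> by (auto dest: tendstoD simp: dist_real_def)
  with small obtain \<delta> where \<delta>: "0 < \<delta>" "\<delta> < \<epsilon>" "\<delta> < \<tau> / 2" "\<delta> < 1 - \<tau>"
    "\<bar>max 0 ((m - (\<tau> - \<delta>)) / (1 - (\<tau> - \<delta>))) - max 0 ((m - \<tau>) / (1 - \<tau>))\<bar> < \<epsilon>"
    using eventually_happens'[OF trivial_limit_at_right_real eventually_conj] by blast
  note ok1 = ok[of \<delta> "\<tau> - \<delta>"]
  have "perturbed_law (\<delta> * m) m (\<tau> - \<delta>) \<in> achievable_laws M m"
    using \<delta> \<tau> M m ok1 by (intro perturbed_law_achievable) auto
  moreover have "measure_pmf.prob (perturbed_law (\<delta> * m) m (\<tau> - \<delta>)) A = max 0 ((m - (\<tau> - \<delta>)) / (1 - (\<tau> - \<delta>)))"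
    if "{\<tau><..} \<subseteq> A" "A \<subseteq> {\<tau>..}" for A
  proof -
    have "1 \<in> A" using that(1) \<tau> by auto
    moreover have "\<tau> - \<delta> \<notin> A" using that(2) \<delta>(1) by auto
    moreover have "\<delta> * m \<notin> A" using that(2) ok1(2) \<delta> \<tau> by fastforce
    ultimately show ?thesis using \<delta> \<tau> m ok1 by (intro prob_perturbed_law(2)) simp_all
  qed
  ultimately show "\<exists>L\<in>achievable_laws M m. near_extremal \<tau> \<epsilon> L \<and>
      (\<forall>A. {\<tau><..} \<subseteq> A \<and> A \<subseteq> {\<tau>..} \<longrightarrow> \<bar>measure_pmf.prob L A - max 0 ((m - \<tau>) / (1 - \<tau>))\<bar> < \<epsilon>)"
    using near[of \<delta> "\<tau> - \<delta>"] \<delta> by (intro bexI[of _ "perturbed_law (\<delta> * m) m (\<tau> - \<delta>)"]) auto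
  have "((\<lambda>\<delta>. min 1 ((m - \<delta> * m) / (\<tau> + \<delta> - \<delta> * m))) \<longlongrightarrow> min 1 ((m - 0 * m) / (\<tau> + 0 - 0 * m))) (at_right (0::real))"
    using \<tau> by (intro tendsto_intros) auto
  then have "eventually (\<lambda>\<delta>. \<bar>min 1 ((m - \<delta> * m) / (\<tau> + \<delta> - \<delta> * m)) - min 1 (m / \<tau>)\<bar> < \<epsilon>) (at_right 0)"
    using \<epsilon> by (auto dest: tendstoD simp: dist_real_def)
  with small obtain \<delta> where \<delta>: "0 < \<delta>" "\<delta> < \<epsilon>" "\<delta> < \<tau> / 2" "\<delta> < 1 - \<tau>"
    "\<bar>min 1 ((m - \<delta> * m) / (\<tau> + \<delta> - \<delta> * m)) - min 1 (m / \<tau>)\<bar> < \<epsilon>"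
    using eventually_happens'[OF trivial_limit_at_right_real eventually_conj] by blast
  note ok2 = ok[of \<delta> "\<tau> + \<delta>"] ok[of \<delta> \<tau>]
  have "perturbed_law (\<delta> * m) m (\<tau> + \<delta>) \<in> achievable_laws M m"
    using \<delta> \<tau> M m ok2 by (intro perturbed_law_achievable) auto
  moreover have "measure_pmf.prob (perturbed_law (\<delta> * m) m (\<tau> + \<delta>)) A = min 1 ((m - \<delta> * m) / (\<tau> + \<delta> - \<delta> * m))"
    if "{\<tau><..} \<subseteq> A" "A \<subseteq> {\<tau>..}" for A
  proof -
    have "1 \<in> A" "\<tau> + \<delta> \<in> A" using that(1) \<delta>(1) \<tau> by auto
    moreover have "\<delta> * m \<notin> A" using that(2) ok2(4) \<delta> \<tau> by fastforce
    ultimately show ?thesis using \<delta> \<tau> m ok2 by (intro prob_perturbed_law(1)) simp_all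
  qed
  ultimately show "\<exists>L\<in>achievable_laws M m. near_extremal \<tau> \<epsilon> L \<and>
      (\<forall>A. {\<tau><..} \<subseteq> A \<and> A \<subseteq> {\<tau>..} \<longrightarrow> \<bar>measure_pmf.prob L A - min 1 (m / \<tau>)\<bar> < \<epsilon>)"
    using near[of \<delta> "\<tau> + \<delta>"] \<delta> by (intro bexI[of _ "perturbed_law (\<delta> * m) m (\<tau> + \<delta>)"]) auto
qed

subsection \<open>Sharpness\<close>

text \<open>On the reals the infimum needs a nonempty set bounded below: the lower bound
  \<open>c\<close> gives the latter, the approximation at \<epsilon> = 1 the former.\<close>

lemma cINF_eq_of_approx:
  fixes f :: "'b \<Rightarrow> real"
  assumes "\<And>x. x \<in> X \<Longrightarrow> c \<le> f x" "\<And>\<epsilon>. \<epsilon> > 0 \<Longrightarrow> \<exists>x\<in>X. \<bar>f x - c\<bar> < \<epsilon>"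
  shows "(INF x\<in>X. f x) = c"
proof (rule antisym)
  show "(INF x\<in>X. f x) \<le> c"
  proof (rule field_le_epsilon)
    fix \<epsilon> :: real assume "\<epsilon> > 0"
    then obtain x where "x \<in> X" "\<bar>f x - c\<bar> < \<epsilon>" using assms(2) by blast
    then show "(INF x\<in>X. f x) \<le> c + \<epsilon>"
      using assms(1) by (intro cINF_lower2[of _ _ x]) (auto intro!: bdd_belowI2)
  qed
  show "c \<le> (INF x\<in>X. f x)" using assms(1) assms(2)[of 1] by (intro cINF_greatest) auto
qed

lemma cSUP_eq_of_approx:
  fixes f :: "'b \<Rightarrow> real"
  assumes "\<And>x. x \<in> X \<Longrightarrow> f x \<le> c" "\<And>\<epsilon>. \<epsilon> > 0 \<Longrightarrow> \<exists>x\<in>X. \<bar>f x - c\<bar> < \<epsilon>"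
  shows "(SUP x\<in>X. f x) = c"
proof (rule antisym)
  show "c \<le> (SUP x\<in>X. f x)"
  proof (rule field_le_epsilon)
    fix \<epsilon> :: real assume "\<epsilon> > 0"
    then obtain x where x: "x \<in> X" "\<bar>f x - c\<bar> < \<epsilon>" using assms(2) by blast
    then have "f x \<le> (SUP x\<in>X. f x)" using assms(1) by (intro cSUP_upper) (auto intro!: bdd_aboveI2)
    then show "c \<le> (SUP x\<in>X. f x) + \<epsilon>" using x by linarith
  qed
  show "(SUP x\<in>X. f x) \<le> c" using assms(1) assms(2)[of 1] by (intro cSUP_least) auto
qed

section \<open>Tails of the extremal laws\<close>

lemma prob_extremal_law:
  assumes m: "m \<in> {0..1}" and s: "s \<in> {0<..<1}" and A: "0 \<notin> A" "1 \<in> A"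
  shows "s \<in> A \<Longrightarrow> measure_pmf.prob (extremal_law m s) A = min 1 (m / s)"
    and "s \<notin> A \<Longrightarrow> measure_pmf.prob (extremal_law m s) A = max 0 ((m - s) / (1 - s))"
proof -
  have "0 \<le> m" "m \<le> 1" "0 < s" "s < 1" using m s by auto
  note prob = prob_perturbed_law[OF order_refl this A, folded extremal_law_eq, unfolded diff_0_right]
  show "s \<in> A \<Longrightarrow> measure_pmf.prob (extremal_law m s) A = min 1 (m / s)" by (rule prob(1))
  show "s \<notin> A \<Longrightarrow> measure_pmf.prob (extremal_law m s) A = max 0 ((m - s) / (1 - s))" by (rule prob(2))
qed

lemma prob_lower_ray:
  fixes L :: "real pmf"
  shows "measure_pmf.prob L {..\<tau>} = 1 - measure_pmf.prob L {\<tau><..}"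
    and "measure_pmf.prob L {..<\<tau>} = 1 - measure_pmf.prob L {\<tau>..}"
  by (rule prob_pmf_Compl[of L "{\<tau><..}", unfolded Compl_greaterThan],
      rule prob_pmf_Compl[of L "{\<tau>..}", unfolded Compl_atLeast])

text \<open>The atom at \<tau> belongs to the weak ray but not to the strict one, so a single law
  attains the largest weak tail and the smallest strict tail.\<close>

lemma extremal_law_attains:
  assumes m: "m \<in> {0..1}" and \<tau>: "\<tau> \<in> {0<..<1}"
  shows "measure_pmf.prob (extremal_law m \<tau>) {\<tau>..} = min 1 (m / \<tau>)"
    and "measure_pmf.prob (extremal_law m \<tau>) {\<tau><..} = max 0 ((m - \<tau>) / (1 - \<tau>))"
    and "measure_pmf.prob (extremal_law m \<tau>) {..\<tau>} = min 1 ((1 - m) / (1 - \<tau>))"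
    and "measure_pmf.prob (extremal_law m \<tau>) {..<\<tau>} = max 0 (1 - m / \<tau>)"
proof -
  show *: "measure_pmf.prob (extremal_law m \<tau>) {\<tau>..} = min 1 (m / \<tau>)"
    using \<tau> by (intro prob_extremal_law[OF m \<tau>]) auto
  show **: "measure_pmf.prob (extremal_law m \<tau>) {\<tau><..} = max 0 ((m - \<tau>) / (1 - \<tau>))"
    using \<tau> by (intro prob_extremal_law[OF m \<tau>]) auto
  show "measure_pmf.prob (extremal_law m \<tau>) {..\<tau>} = min 1 ((1 - m) / (1 - \<tau>))"
    "measure_pmf.prob (extremal_law m \<tau>) {..<\<tau>} = max 0 (1 - m / \<tau>)"
    unfolding prob_lower_ray * ** one_minus_tail_constants[OF \<tau>] by (rule refl)+
qed

text \<open>For the other two upper constants the atom must leave the weak ray, hence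
  \<open>at_left\<close>, or enter the strict ray, hence \<open>at_right\<close>. Lower tails follow
  by complement.\<close>

lemma extremal_law_approaches:
  assumes m: "m \<in> {0..1}" and \<tau>: "\<tau> \<in> {0<..<1}"
  shows "((\<lambda>s. measure_pmf.prob (extremal_law m s) {\<tau>..}) \<longlongrightarrow> max 0 ((m - \<tau>) / (1 - \<tau>))) (at_left \<tau>)" (is ?A)
    and "((\<lambda>s. measure_pmf.prob (extremal_law m s) {\<tau><..}) \<longlongrightarrow> min 1 (m / \<tau>)) (at_right \<tau>)" (is ?B)
    and "((\<lambda>s. measure_pmf.prob (extremal_law m s) {..\<tau>}) \<longlongrightarrow> max 0 (1 - m / \<tau>)) (at_right \<tau>)"
    and "((\<lambda>s. measure_pmf.prob (extremal_law m s) {..<\<tau>}) \<longlongrightarrow> min 1 ((1 - m) / (1 - \<tau>))) (at_left \<tau>)"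
proof -
  have "((\<lambda>s. max 0 ((m - s) / (1 - s))) \<longlongrightarrow> max 0 ((m - \<tau>) / (1 - \<tau>))) (at_left \<tau>)"
    using \<tau> by (intro tendsto_intros) auto
  moreover have "eventually (\<lambda>s. max 0 ((m - s) / (1 - s)) = measure_pmf.prob (extremal_law m s) {\<tau>..}) (at_left \<tau>)"
    using eventually_at_left_real[of 0 \<tau>] \<tau> m by (auto elim!: eventually_mono simp: prob_extremal_law)
  ultimately show ?A by (rule Lim_transform_eventually)
  from tendsto_diff[OF tendsto_const[of 1] this]
  show "((\<lambda>s. measure_pmf.prob (extremal_law m s) {..<\<tau>}) \<longlongrightarrow> min 1 ((1 - m) / (1 - \<tau>))) (at_left \<tau>)"
    using \<tau> by (simp add: prob_lower_ray one_minus_tail_constants)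
  have "((\<lambda>s. min 1 (m / s)) \<longlongrightarrow> min 1 (m / \<tau>)) (at_right \<tau>)"
    using \<tau> by (intro tendsto_intros) auto
  moreover have "eventually (\<lambda>s. min 1 (m / s) = measure_pmf.prob (extremal_law m s) {\<tau><..}) (at_right \<tau>)"
    using eventually_at_right_real[of \<tau> 1] \<tau> m by (auto elim!: eventually_mono simp: prob_extremal_law)
  ultimately show ?B by (rule Lim_transform_eventually)
  from tendsto_diff[OF tendsto_const[of 1] this]
  show "((\<lambda>s. measure_pmf.prob (extremal_law m s) {..\<tau>}) \<longlongrightarrow> max 0 (1 - m / \<tau>)) (at_right \<tau>)"
    using \<tau> by (simp add: prob_lower_ray one_minus_tail_constants)
qed

section \<open>Exact infima and suprema over achievable laws\<close>

lemma approx_upper_tails: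
  fixes M m \<tau> \<epsilon> :: real
  assumes "0 < M" "M \<le> 1" "M = 1 \<Longrightarrow> 0 < m" "m \<in> {0..1}" "\<tau> \<in> {0<..<1}" "\<epsilon> > 0"
    "A \<in> {{\<tau>..}, {\<tau><..}}" "c \<in> {max 0 ((m - \<tau>) / (1 - \<tau>)), min 1 (m / \<tau>)}"
  shows "\<exists>L\<in>achievable_laws M m. near_extremal \<tau> \<epsilon> L \<and> \<bar>measure_pmf.prob L A - c\<bar> < \<epsilon>"
proof -
  have A: "{\<tau><..} \<subseteq> A \<and> A \<subseteq> {\<tau>..}" using assms by auto
  have "0 \<le> m" "m \<le> 1" using assms(4) by auto
  note approx = approx_tail_constants[OF assms(1-3) this assms(5,6)]
  from assms(8) show ?thesis using approx A by (elim insertE emptyE) blast+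
qed

lemma approx_lower_tails:
  fixes M m \<tau> \<epsilon> :: real
  assumes M: "0 < M" "M \<le> 1" "M = 1 \<Longrightarrow> 0 < m" "m \<in> {0..1}" and \<tau>: "\<tau> \<in> {0<..<1}" and \<epsilon>: "\<epsilon> > 0"
    and A: "A \<in> {{..\<tau>}, {..<\<tau>}}" and c: "c \<in> {max 0 (1 - m / \<tau>), min 1 ((1 - m) / (1 - \<tau>))}"
  shows "\<exists>L\<in>achievable_laws M m. near_extremal \<tau> \<epsilon> L \<and> \<bar>measure_pmf.prob L A - c\<bar> < \<epsilon>"
proof -
  have A': "- A \<in> {{\<tau>..}, {\<tau><..}}" using A by auto
  have c': "1 - c \<in> {max 0 ((m - \<tau>) / (1 - \<tau>)), min 1 (m / \<tau>)}"
    using c unfolding one_minus_tail_constants[OF \<tau>] by auto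
  obtain L where L: "L \<in> achievable_laws M m" "near_extremal \<tau> \<epsilon> L" "\<bar>measure_pmf.prob L (- A) - (1 - c)\<bar> < \<epsilon>"
    using approx_upper_tails[OF M \<tau> \<epsilon> A' c'] by blast
  then have "\<bar>measure_pmf.prob L A - c\<bar> < \<epsilon>" unfolding prob_pmf_Compl by linarith
  with L show ?thesis by blast
qed

lemma lower_tail_bounds:
  fixes L :: "real pmf"
  assumes L: "set_pmf L \<subseteq> {0..1}" and \<tau>: "\<tau> \<in> {0<..<1}" and A: "{..<\<tau>} \<subseteq> A" "A \<subseteq> {..\<tau>}"
    and m: "m = measure_pmf.expectation L (\<lambda>y. y)"
  shows "max 0 (1 - m / \<tau>) \<le> measure_pmf.prob L A" "measure_pmf.prob L A \<le> min 1 ((1 - m) / (1 - \<tau>))"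
proof -
  have "{\<tau><..} \<subseteq> - A" "- A \<subseteq> {\<tau>..}"
    using Compl_anti_mono[OF A(1)] Compl_anti_mono[OF A(2)] by simp_all
  from upper_tail_bounds[OF L \<tau> this m]
  show "max 0 (1 - m / \<tau>) \<le> measure_pmf.prob L A" "measure_pmf.prob L A \<le> min 1 ((1 - m) / (1 - \<tau>))"
    unfolding one_minus_tail_constants[OF \<tau>] prob_pmf_Compl by linarith+
qed

lemma sharp_upper_tails:
  fixes M m \<tau> :: real
  assumes M: "0 < M" "M \<le> 1" "M = 1 \<Longrightarrow> 0 < m" "m \<in> {0..1}" and \<tau>: "\<tau> \<in> {0<..<1}"
    and A: "A \<in> {{\<tau>..}, {\<tau><..}}"
  shows "(INF L\<in>achievable_laws M m. measure_pmf.prob L A) = max 0 ((m - \<tau>) / (1 - \<tau>))"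
    and "(SUP L\<in>achievable_laws M m. measure_pmf.prob L A) = min 1 (m / \<tau>)"
proof -
  have A': "{\<tau><..} \<subseteq> A" "A \<subseteq> {\<tau>..}" using A by auto
  note bounds = upper_tail_bounds[OF achievable_law_bounds(1)[OF M(1)] \<tau> A' achievable_law_bounds(2)[OF M(1), symmetric]]
  show "(INF L\<in>achievable_laws M m. measure_pmf.prob L A) = max 0 ((m - \<tau>) / (1 - \<tau>))"
    using bounds(1) approx_upper_tails[OF M \<tau> _ A] by (intro cINF_eq_of_approx) blast+
  show "(SUP L\<in>achievable_laws M m. measure_pmf.prob L A) = min 1 (m / \<tau>)"
    using bounds(2) approx_upper_tails[OF M \<tau> _ A] by (intro cSUP_eq_of_approx) blast+
qed

lemma sharp_lower_tails:
  fixes M m \<tau> :: real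
  assumes M: "0 < M" "M \<le> 1" "M = 1 \<Longrightarrow> 0 < m" "m \<in> {0..1}" and \<tau>: "\<tau> \<in> {0<..<1}"
    and A: "A \<in> {{..\<tau>}, {..<\<tau>}}"
  shows "(INF L\<in>achievable_laws M m. measure_pmf.prob L A) = max 0 (1 - m / \<tau>)"
    and "(SUP L\<in>achievable_laws M m. measure_pmf.prob L A) = min 1 ((1 - m) / (1 - \<tau>))"
proof -
  have A': "{..<\<tau>} \<subseteq> A" "A \<subseteq> {..\<tau>}" using A by auto
  note bounds = lower_tail_bounds[OF achievable_law_bounds(1)[OF M(1)] \<tau> A' achievable_law_bounds(2)[OF M(1), symmetric]]
  show "(INF L\<in>achievable_laws M m. measure_pmf.prob L A) = max 0 (1 - m / \<tau>)"
    using bounds(1) approx_lower_tails[OF M \<tau> _ A] by (intro cINF_eq_of_approx) blast+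
  show "(SUP L\<in>achievable_laws M m. measure_pmf.prob L A) = min 1 ((1 - m) / (1 - \<tau>))"
    using bounds(2) approx_lower_tails[OF M \<tau> _ A] by (intro cSUP_eq_of_approx) blast+
qed

theorem theorem3p5:
  fixes S :: "'a set" and P :: "'a \<Rightarrow> 'a pmf" and \<pi> \<nu> :: "'a pmf" and M m :: real
  assumes chain: "stationary_chain S P \<pi>"
    and M: "M = max_retention S P \<pi>"
    and M_pos: "M > 0"
    and \<nu>: "set_pmf \<nu> \<subseteq> S"
    and m: "m = mean_normalized S P \<pi> \<nu>"
  shows
    "(\<forall>x\<in>S. normalized S P \<pi> x \<in> {0..1}) \<and>
     m = (\<Sum>x\<in>S. pmf \<nu> x * retention S P \<pi> x / M) \<and>
     \<comment> \<open>the tail bounds\<close>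
     (\<forall>\<tau>\<in>{0<..<1}.
        max 0 ((m - \<tau>) / (1 - \<tau>)) \<le> measure_pmf.prob \<nu> {x\<in>S. retention S P \<pi> x \<ge> \<tau> * M} \<and>
        measure_pmf.prob \<nu> {x\<in>S. retention S P \<pi> x \<ge> \<tau> * M} \<le> min 1 (m / \<tau>)) \<and>
     (\<forall>\<tau>\<in>{0<..<1}.
        max 0 (1 - m / \<tau>) \<le> measure_pmf.prob \<nu> {x\<in>S. retention S P \<pi> x \<le> \<tau> * M} \<and>
        measure_pmf.prob \<nu> {x\<in>S. retention S P \<pi> x \<le> \<tau> * M} \<le> min 1 ((1 - m) / (1 - \<tau>))) \<and>
     \<comment> \<open>given only m and M, no bound can be improved, for weak or for strict thresholds\<close>
     (\<forall>\<tau>\<in>{0<..<1}.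
        (\<forall>A\<in>{{\<tau>..}, {\<tau><..}}.
           (INF L\<in>achievable_laws M m. measure_pmf.prob L A) = max 0 ((m - \<tau>) / (1 - \<tau>)) \<and>
           (SUP L\<in>achievable_laws M m. measure_pmf.prob L A) = min 1 (m / \<tau>)) \<and>
        (\<forall>A\<in>{{..\<tau>}, {..<\<tau>}}.
           (INF L\<in>achievable_laws M m. measure_pmf.prob L A) = max 0 (1 - m / \<tau>) \<and>
           (SUP L\<in>achievable_laws M m. measure_pmf.prob L A) = min 1 ((1 - m) / (1 - \<tau>)))) \<and>
     \<comment> \<open>the two-point laws: support and mean\<close>
     (\<forall>s\<in>{0<..<1}.
        (set_pmf (extremal_law m s) \<subseteq> {0, s} \<or> set_pmf (extremal_law m s) \<subseteq> {s, 1}) \<and>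
        measure_pmf.expectation (extremal_law m s) (\<lambda>y. y) = m) \<and>
     \<comment> \<open>constants attained by the two-point law at the threshold\<close>
     (\<forall>\<tau>\<in>{0<..<1}.
        measure_pmf.prob (extremal_law m \<tau>) {\<tau>..} = min 1 (m / \<tau>) \<and>
        measure_pmf.prob (extremal_law m \<tau>) {\<tau><..} = max 0 ((m - \<tau>) / (1 - \<tau>)) \<and>
        measure_pmf.prob (extremal_law m \<tau>) {..\<tau>} = min 1 ((1 - m) / (1 - \<tau>)) \<and>
        measure_pmf.prob (extremal_law m \<tau>) {..<\<tau>} = max 0 (1 - m / \<tau>)) \<and>
     \<comment> \<open>constants approached as the support point tends to the threshold\<close>
     (\<forall>\<tau>\<in>{0<..<1}.
        ((\<lambda>s. measure_pmf.prob (extremal_law m s) {\<tau>..}) \<longlongrightarrow> max 0 ((m - \<tau>) / (1 - \<tau>))) (at_left \<tau>) \<and>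
        ((\<lambda>s. measure_pmf.prob (extremal_law m s) {\<tau><..}) \<longlongrightarrow> min 1 (m / \<tau>)) (at_right \<tau>) \<and>
        ((\<lambda>s. measure_pmf.prob (extremal_law m s) {..\<tau>}) \<longlongrightarrow> max 0 (1 - m / \<tau>)) (at_right \<tau>) \<and>
        ((\<lambda>s. measure_pmf.prob (extremal_law m s) {..<\<tau>}) \<longlongrightarrow> min 1 ((1 - m) / (1 - \<tau>))) (at_left \<tau>)) \<and>
     \<comment> \<open>the two-point laws come from actual chains with the same m and M\<close>
     (M < 1 \<longrightarrow> (\<forall>s\<in>{0<..<1}. extremal_law m s \<in> achievable_laws M m)) \<and>
     (\<forall>\<tau>\<in>{0<..<1}. \<forall>\<epsilon>>0.
        (\<forall>A\<in>{{\<tau>..}, {\<tau><..}}. \<forall>c\<in>{max 0 ((m - \<tau>) / (1 - \<tau>)), min 1 (m / \<tau>)}.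
           \<exists>L\<in>achievable_laws M m. near_extremal \<tau> \<epsilon> L \<and> \<bar>measure_pmf.prob L A - c\<bar> < \<epsilon>) \<and>
        (\<forall>A\<in>{{..\<tau>}, {..<\<tau>}}. \<forall>c\<in>{max 0 (1 - m / \<tau>), min 1 ((1 - m) / (1 - \<tau>))}.
           \<exists>L\<in>achievable_laws M m. near_extremal \<tau> \<epsilon> L \<and> \<bar>measure_pmf.prob L A - c\<bar> < \<epsilon>))"
proof -
  have M1: "M \<le> 1" unfolding M by (rule max_retention_le_1[OF chain])
  have m01: "m \<in> {0..1}"
    unfolding m using M M_pos by (intro mean_normalized_bounds[OF chain _ \<nu>]) simp
  have m_pos: "M = 1 \<Longrightarrow> 0 < m"
    unfolding m using M by (intro mean_normalized_pos[OF chain _ \<nu>]) simp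
  have norm: "\<forall>x\<in>S. normalized S P \<pi> x \<in> {0..1}"
    using normalized_bounds[OF chain] M M_pos by simp
  have mean: "m = (\<Sum>x\<in>S. pmf \<nu> x * retention S P \<pi> x / M)"
    unfolding m mean_normalized_eq_sum[OF chain \<nu>] normalized_def M by simp
  define L where "L = map_pmf (normalized S P \<pi>) \<nu>"
  have L01: "set_pmf L \<subseteq> {0..1}" using norm \<nu> by (auto simp: L_def)
  have Lm: "m = measure_pmf.expectation L (\<lambda>y. y)" by (simp add: L_def m mean_normalized_def)
  \<comment> \<open>Restricting to \<open>S\<close> changes the preimage of \<open>A\<close> only by
    a \<nu>-null set.\<close>
  have prob: "measure_pmf.prob \<nu> {x \<in> S. normalized S P \<pi> x \<in> A} = measure_pmf.prob L A" for A
    unfolding L_def measure_map_pmf using \<nu>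
    by (intro measure_pmf.finite_measure_eq_AE) (auto simp: AE_measure_pmf_iff)
  have sets: "{x\<in>S. retention S P \<pi> x \<ge> \<tau> * M} = {x \<in> S. normalized S P \<pi> x \<in> {\<tau>..}}"
    "{x\<in>S. retention S P \<pi> x \<le> \<tau> * M} = {x \<in> S. normalized S P \<pi> x \<in> {..\<tau>}}" for \<tau>
    using M_pos by (auto simp: normalized_def M field_simps)
  have upper: "\<forall>\<tau>\<in>{0<..<1}.
        max 0 ((m - \<tau>) / (1 - \<tau>)) \<le> measure_pmf.prob \<nu> {x\<in>S. retention S P \<pi> x \<ge> \<tau> * M} \<and>
        measure_pmf.prob \<nu> {x\<in>S. retention S P \<pi> x \<ge> \<tau> * M} \<le> min 1 (m / \<tau>)"
    unfolding sets prob using upper_tail_bounds[OF L01 _ _ _ Lm] by (simp add: Ioi_le_Ico)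
  have lower: "\<forall>\<tau>\<in>{0<..<1}.
        max 0 (1 - m / \<tau>) \<le> measure_pmf.prob \<nu> {x\<in>S. retention S P \<pi> x \<le> \<tau> * M} \<and>
        measure_pmf.prob \<nu> {x\<in>S. retention S P \<pi> x \<le> \<tau> * M} \<le> min 1 ((1 - m) / (1 - \<tau>))"
    unfolding sets prob using lower_tail_bounds[OF L01 _ _ _ Lm] by (simp add: subset_iff)
  have support: "set_pmf (extremal_law m s) \<subseteq> {0, s} \<or> set_pmf (extremal_law m s) \<subseteq> {s, 1}" for s
    using set_perturbed_law[of 0 m s] by (simp add: extremal_law_eq)
  have law_mean: "measure_pmf.expectation (extremal_law m s) (\<lambda>y. y) = m" if "s \<in> {0<..<1}" for s
    using expectation_perturbed_law[of 0 m s] m01 that by (simp add: extremal_law_eq)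
  have achieved: "extremal_law m s \<in> achievable_laws M m" if "M < 1" "s \<in> {0<..<1}" for s
    using perturbed_law_achievable[of M 0 m s] M_pos m01 that by (simp add: extremal_law_eq)
  note sharp = sharp_upper_tails[OF M_pos M1 m_pos m01] sharp_lower_tails[OF M_pos M1 m_pos m01]
  note approx = approx_upper_tails[OF M_pos M1 m_pos m01] approx_lower_tails[OF M_pos M1 m_pos m01]
  note attained = extremal_law_attains[OF m01]
  note approached = extremal_law_approaches[OF m01]
  show ?thesis
    by (intro conjI norm mean upper lower;
        intro ballI allI impI conjI sharp support law_mean attained approached achieved approx; assumption)
qed

end
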